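(* Let $R>0$. There is a constant $C>0$ depending only on $R$ (not on $k$ or $d$) such that for any $k$-atomic distributions $\Gamma,\Gamma'$ supported on the Euclidean ball $B(0,R)\subset\mathbb R^d$ and any $D\in\{H^2,\mathrm{KL},\chi^2\}$, $$(Ck)^{-4k}\max_{1\le\ell\le 2k-1}\|M_\ell(\Gamma)-M_\ell(\Gamma')\|_F^2\le D(P_\Gamma\,\|\,P_{\Gamma'})\le C e^{36k^2}\max_{1\le\ell\le2k-1}\|M_\ell(\Gamma)-M_\ell(\Gamma')\|_F^2.$$
   Context: $P_\Gamma=\Gamma*N(0,I_d)$. $M_\ell(\Gamma)=\mathbb E_{U\sim\Gamma}[U^{\otimes\ell}]\in(\mathbb R^d)^{\otimes\ell}$ is the order-$\ell$ moment tensor; for $\Gamma=\sum_j w_j\delta_{\mu_j}$, $M_\ell(\Gamma)=\sum_j w_j\mu_j^{\otimes\ell}$. $\|T\|_F=(\sum_{j_1,\dots,j_\ell}T_{j_1\dots j_\ell}^2)^{1/2}$. $H^2(P,Q)=\int(\sqrt p-\sqrt q)^2$, $\mathrm{KL}(P\|Q)=\int p\log(p/q)$, $\chi^2(P\|Q)=\int (p-q)^2/q$. *)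

theory Defs
  imports "HOL-Analysis.Analysis"
begin

text \<open>Points of R^d are represented as functions nat => real, only coordinates i < d matter.
  Lebesgue measure on R^d is the product measure of lborel over the index set {..<d}.\<close>

definition lebesgue_d :: "nat \<Rightarrow> (nat \<Rightarrow> real) measure" where
  "lebesgue_d d = PiM {..<d} (\<lambda>_. lborel)"

definition eucl_norm :: "nat \<Rightarrow> (nat \<Rightarrow> real) \<Rightarrow> real" where
  "eucl_norm d x = sqrt (\<Sum>i<d. (x i)\<^sup>2)"

definition gauss_density :: "nat \<Rightarrow> (nat \<Rightarrow> real) \<Rightarrow> (nat \<Rightarrow> real) \<Rightarrow> real" where
  "gauss_density d m x = (2 * pi) powr (- real d / 2) * exp (- (\<Sum>i<d. (x i - m i)\<^sup>2) / 2)"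

text \<open>A k-atomic distribution Gamma = sum_{j<k} w j delta_{mu j} supported in the closed ball B(0,R).\<close>
definition katomic_ball :: "real \<Rightarrow> nat \<Rightarrow> nat \<Rightarrow> (nat \<Rightarrow> real) \<Rightarrow> (nat \<Rightarrow> nat \<Rightarrow> real) \<Rightarrow> bool" where
  "katomic_ball R d k w \<mu> \<longleftrightarrow>
     (\<forall>j<k. w j \<ge> 0) \<and> (\<Sum>j<k. w j) = 1 \<and> (\<forall>j<k. eucl_norm d (\<mu> j) \<le> R)"

definition mixture_density :: "nat \<Rightarrow> nat \<Rightarrow> (nat \<Rightarrow> real) \<Rightarrow> (nat \<Rightarrow> nat \<Rightarrow> real) \<Rightarrow> (nat \<Rightarrow> real) \<Rightarrow> real" where
  "mixture_density d k w \<mu> x = (\<Sum>j<k. w j * gauss_density d (\<mu> j) x)"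

definition moment_entry :: "nat \<Rightarrow> nat \<Rightarrow> (nat \<Rightarrow> real) \<Rightarrow> (nat \<Rightarrow> nat \<Rightarrow> real) \<Rightarrow> (nat \<Rightarrow> nat) \<Rightarrow> real" where
  "moment_entry k l w \<mu> idx = (\<Sum>j<k. w j * (\<Prod>i<l. \<mu> j (idx i)))"

definition moment_diff_frob_sq ::
  "nat \<Rightarrow> nat \<Rightarrow> nat \<Rightarrow> (nat \<Rightarrow> real) \<Rightarrow> (nat \<Rightarrow> nat \<Rightarrow> real) \<Rightarrow> (nat \<Rightarrow> real) \<Rightarrow> (nat \<Rightarrow> nat \<Rightarrow> real) \<Rightarrow> real" where
  "moment_diff_frob_sq d k l w \<mu> w' \<mu>' =
     (\<Sum>idx \<in> PiE {..<l} (\<lambda>_. {..<d}). (moment_entry k l w \<mu> idx - moment_entry k l w' \<mu>' idx)\<^sup>2)"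

definition hellinger_sq :: "nat \<Rightarrow> ((nat \<Rightarrow> real) \<Rightarrow> real) \<Rightarrow> ((nat \<Rightarrow> real) \<Rightarrow> real) \<Rightarrow> real" where
  "hellinger_sq d p q = (\<integral>x. (sqrt (p x) - sqrt (q x))\<^sup>2 \<partial>lebesgue_d d)"

definition kl_div :: "nat \<Rightarrow> ((nat \<Rightarrow> real) \<Rightarrow> real) \<Rightarrow> ((nat \<Rightarrow> real) \<Rightarrow> real) \<Rightarrow> real" where
  "kl_div d p q = (\<integral>x. p x * ln (p x / q x) \<partial>lebesgue_d d)"

definition chi_sq :: "nat \<Rightarrow> ((nat \<Rightarrow> real) \<Rightarrow> real) \<Rightarrow> ((nat \<Rightarrow> real) \<Rightarrow> real) \<Rightarrow> real" where
  "chi_sq d p q = (\<integral>x. (p x - q x)\<^sup>2 / q x \<partial>lebesgue_d d)"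

end

theory Submission
  imports Defs "HOL-Probability.Distributions"
begin

text \<open>
  Write \<open>p - q = \<Sum>\<^sub>i c\<^sub>i \<phi>(x - x\<^sub>i)\<close> with \<open>n = 2k\<close> signed atoms. Completing the square gives
  \<open>\<integral> (p - q)\<^sup>2 / \<phi>(x - a) = E(a) := \<Sum>\<^sub>i\<^sub>j c\<^sub>i c\<^sub>j exp \<langle>x\<^sub>i - a, x\<^sub>j - a\<rangle>\<close>, and expanding the exponential
  turns \<open>E(a)\<close> into the sum over \<open>l\<close> of the squared Frobenius norms of the moment differences centred
  at \<open>a\<close>, divided by \<open>l!\<close>. High moments are controlled by those of order below \<open>n\<close> because
  \<open>(x - x\<^sub>0) \<otimes> \<dots> \<otimes> (x - x\<^bsub>n-1\<^esub>)\<close> vanishes at every atom: Newton interpolation with tensor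
  products bounds the squared norm of order \<open>l\<close> by \<open>\<beta>\<^sup>l M\<close> with \<open>\<beta>\<close> depending only on \<open>R\<close>, whatever the
  dimension. Hence \<open>E(a) \<le> exp \<beta> * M\<close> for \<open>\<bar>a\<bar> \<le> R\<close>.

  Since \<open>H\<^sup>2 \<le> KL \<le> \<chi>\<^sup>2\<close>, only an upper bound on \<open>\<chi>\<^sup>2\<close> and a lower bound on \<open>H\<^sup>2\<close> are needed.
  The former follows from \<open>q \<ge> \<phi>(x - \<mu>'\<^sub>j) / k\<close> for the heaviest atom. For the latter, test \<open>p - q\<close>
  against \<open>f = (p - q) / \<phi>\<close>: the pairing is \<open>E(0) \<ge> M / (2k)!\<close>, whereas
  \<open>f\<^sup>2 \<phi>(x - \<mu>) = exp (- \<bar>\<mu>\<bar>\<^sup>2) (p - q)\<^sup>2 / \<phi>(x + \<mu>)\<close> shows that \<open>f\<close> has second moments at most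
  \<open>exp \<beta> * M\<close> under \<open>p\<close> and \<open>q\<close>; AM-GM then compares the two with \<open>H\<^sup>2\<close>.
\<close>

section \<open>Newton interpolation for signed moment tensors\<close>

definition ip :: "nat \<Rightarrow> (nat \<Rightarrow> real) \<Rightarrow> (nat \<Rightarrow> real) \<Rightarrow> real" where
  "ip d u v = (\<Sum>t<d. u t * v t)"

lemma ip_self_nonneg: "0 \<le> ip d u u"
  unfolding ip_def by (intro sum_nonneg) simp

text \<open>For a kernel that is a product of inner products, this is the squared norm of a weighted
  sum of rank-one tensors. Handling tensors through their Gram kernels keeps \<open>d\<close> out of
  every constant.\<close>

definition qform :: "nat \<Rightarrow> (nat \<Rightarrow> real) \<Rightarrow> (nat \<Rightarrow> nat \<Rightarrow> real) \<Rightarrow> real" where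
  "qform n c \<kappa> = (\<Sum>i<n. \<Sum>j<n. c i * c j * \<kappa> i j)"

text \<open>All weights are quantified because \<open>qform_mult_ip\<close> produces forms with the
  altered weights \<open>c i * u i t\<close>.\<close>

definition psd :: "nat \<Rightarrow> (nat \<Rightarrow> nat \<Rightarrow> real) \<Rightarrow> bool" where
  "psd n \<kappa> \<longleftrightarrow> (\<forall>c. 0 \<le> qform n c \<kappa>)"

text \<open>Multiplying the kernel by a Gram kernel appends a tensor factor \<open>u i\<close>; the
  right-hand side splits the squared norm into slices along the new index \<open>t\<close>.\<close>

lemma qform_mult_ip:
  "qform n c (\<lambda>i j. \<kappa> i j * ip d (u i) (u j)) = (\<Sum>t<d. qform n (\<lambda>i. c i * u i t) \<kappa>)"
proof -
  have "qform n c (\<lambda>i j. \<kappa> i j * ip d (u i) (u j)) =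
      (\<Sum>i<n. \<Sum>j<n. \<Sum>t<d. c i * u i t * (c j * u j t) * \<kappa> i j)"
    unfolding qform_def ip_def by (simp add: sum_distrib_left mult_ac)
  also have "\<dots> = (\<Sum>i<n. \<Sum>t<d. \<Sum>j<n. c i * u i t * (c j * u j t) * \<kappa> i j)"
    by (intro sum.cong refl sum.swap)
  also have "\<dots> = (\<Sum>t<d. \<Sum>i<n. \<Sum>j<n. c i * u i t * (c j * u j t) * \<kappa> i j)"
    by (rule sum.swap)
  finally show ?thesis unfolding qform_def .
qed

lemma psd_mult_ip:
  assumes "psd n \<kappa>" shows "psd n (\<lambda>i j. \<kappa> i j * ip d (u i) (u j))"
  using assms unfolding psd_def qform_mult_ip by (auto intro: sum_nonneg)

lemma psd_one: "psd n (\<lambda>i j. 1)"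
proof -
  have "qform n c (\<lambda>i j. 1) = (\<Sum>i<n. c i)\<^sup>2" for c
    unfolding qform_def by (simp add: power2_eq_square sum_product)
  then show ?thesis unfolding psd_def by simp
qed

lemma psd_mult_ip_power:
  assumes "psd n \<kappa>" shows "psd n (\<lambda>i j. \<kappa> i j * ip d (u i) (u j) ^ s)"
proof (induction s)
  case (Suc s)
  from psd_mult_ip[OF Suc, of d u] show ?case by (simp add: mult_ac)
qed (use assms in simp)

lemma qform_parallelogram:
  "qform n (\<lambda>i. b i + c i) \<kappa> + qform n (\<lambda>i. b i - c i) \<kappa> = 2 * qform n b \<kappa> + 2 * qform n c \<kappa>"
  unfolding qform_def sum_distrib_left sum.distrib[symmetric]
  by (intro sum.cong refl) (simp add: algebra_simps)

text \<open>The tensor form of |A + B|^2 <= 2 |A|^2 + 2 |B|^2, applied slice by slice: the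
  parallelogram law holds and the form of the difference is nonnegative.\<close>

lemma qform_shift_le:
  assumes "psd n \<kappa>"
  shows "qform n c (\<lambda>i j. \<kappa> i j * ip d (\<lambda>t. u i t + b t) (\<lambda>t. u j t + b t))
    \<le> 2 * qform n c (\<lambda>i j. \<kappa> i j * ip d (u i) (u j)) + 2 * ip d b b * qform n c \<kappa>"
proof -
  have scale: "qform n (\<lambda>i. c i * r) \<kappa> = r * r * qform n c \<kappa>" for r
    unfolding qform_def by (simp add: sum_distrib_left mult_ac)
  have "qform n (\<lambda>i. c i * (u i t + b t)) \<kappa>
      \<le> 2 * qform n (\<lambda>i. c i * u i t) \<kappa> + 2 * (b t * b t * qform n c \<kappa>)" for t
  proof -
    have "0 \<le> qform n (\<lambda>i. c i * u i t - c i * b t) \<kappa>"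
      using assms unfolding psd_def by blast
    then show ?thesis
      using qform_parallelogram[of n "\<lambda>i. c i * u i t" "\<lambda>i. c i * b t" \<kappa>]
      by (simp add: scale distrib_left)
  qed
  then have "(\<Sum>t<d. qform n (\<lambda>i. c i * (u i t + b t)) \<kappa>)
     \<le> (\<Sum>t<d. 2 * qform n (\<lambda>i. c i * u i t) \<kappa> + 2 * (b t * b t * qform n c \<kappa>))"
    by (intro sum_mono)
  also have "\<dots> = 2 * (\<Sum>t<d. qform n (\<lambda>i. c i * u i t) \<kappa>) + 2 * ip d b b * qform n c \<kappa>"
    by (simp add: sum.distrib sum_distrib_left sum_distrib_right ip_def mult_ac)
  finally show ?thesis
    unfolding qform_mult_ip[of n c \<kappa> d u] qform_mult_ip[of n c \<kappa> d "\<lambda>i t. u i t + b t"] .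
qed

text \<open>The squared Frobenius norm of \<open>\<Sum>\<^sub>i c\<^sub>i (x\<^sub>i - x\<^sub>0) \<otimes> \<dots> \<otimes> (x\<^sub>i - x\<^bsub>r-1\<^esub>) \<otimes> (x\<^sub>i - a)\<^sup>\<otimes>\<^sup>s\<close>
  is \<open>qform n c\<close> of this kernel.\<close>
definition newton_kernel ::
  "nat \<Rightarrow> (nat \<Rightarrow> nat \<Rightarrow> real) \<Rightarrow> (nat \<Rightarrow> real) \<Rightarrow> nat \<Rightarrow> nat \<Rightarrow> nat \<Rightarrow> nat \<Rightarrow> real" where
  "newton_kernel d x a r s i j =
     (\<Prod>m<r. ip d (\<lambda>t. x i t - x m t) (\<lambda>t. x j t - x m t)) *
     ip d (\<lambda>t. x i t - a t) (\<lambda>t. x j t - a t) ^ s"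

lemma psd_newton_kernel: "psd n (newton_kernel d x a r s)"
proof -
  have "psd n (\<lambda>i j. \<Prod>m<r. ip d (\<lambda>t. x i t - x m t) (\<lambda>t. x j t - x m t))"
    by (induction r) (simp_all add: psd_one psd_mult_ip)
  from psd_mult_ip_power[OF this, of d "\<lambda>i t. x i t - a t"] show ?thesis
    unfolding newton_kernel_def .
qed

lemma qform_newton_kernel_nonneg: "0 \<le> qform n c (newton_kernel d x a r s)"
  using psd_newton_kernel unfolding psd_def by blast

lemma newton_kernel_no_nodes:
  "newton_kernel d x a 0 s = (\<lambda>i j. ip d (\<lambda>t. x i t - a t) (\<lambda>t. x j t - a t) ^ s)"
  by (intro ext) (simp add: newton_kernel_def)

lemma newton_kernel_power_0: "newton_kernel d x a r 0 = newton_kernel d x b r 0"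
  by (intro ext) (simp add: newton_kernel_def)

lemma newton_kernel_Suc_power:
  "newton_kernel d x a r (Suc s) =
   (\<lambda>i j. newton_kernel d x a r s i j * ip d (\<lambda>t. x i t - a t) (\<lambda>t. x j t - a t))"
  by (intro ext) (simp add: newton_kernel_def)

lemma newton_kernel_Suc_node:
  "newton_kernel d x a (Suc r) s =
   (\<lambda>i j. newton_kernel d x a r s i j * ip d (\<lambda>t. x i t - x r t) (\<lambda>t. x j t - x r t))"
  by (intro ext) (simp add: newton_kernel_def)

text \<open>Writing x_i - a = (x_i - x_r) + (x_r - a) trades one power for a new node, or drops it
  at the cost of a constant vector.\<close>

lemma newton_kernel_Suc_power_le:
  "qform n c (newton_kernel d x a r (Suc s))
   \<le> 2 * qform n c (newton_kernel d x a (Suc r) s)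
     + 2 * ip d (\<lambda>t. x r t - a t) (\<lambda>t. x r t - a t) * qform n c (newton_kernel d x a r s)"
proof -
  have "x i t - x r t + (x r t - a t) = x i t - a t" for i t by simp
  then show ?thesis
    using qform_shift_le[OF psd_newton_kernel, of n c d x a r s d "\<lambda>i t. x i t - x r t" "\<lambda>t. x r t - a t"]
    by (simp only: newton_kernel_Suc_power newton_kernel_Suc_node)
qed

text \<open>The reverse trade, from x_i - x_r = (x_i - a) + (a - x_r).\<close>

lemma newton_kernel_Suc_node_le:
  "qform n c (newton_kernel d x a (Suc r) s)
   \<le> 2 * qform n c (newton_kernel d x a r (Suc s))
     + 2 * ip d (\<lambda>t. a t - x r t) (\<lambda>t. a t - x r t) * qform n c (newton_kernel d x a r s)"
proof -
  have "x i t - a t + (a t - x r t) = x i t - x r t" for i t by simp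
  then show ?thesis
    using qform_shift_le[OF psd_newton_kernel, of n c d x a r s d "\<lambda>i t. x i t - a t" "\<lambda>t. a t - x r t"]
    by (simp only: newton_kernel_Suc_power newton_kernel_Suc_node)
qed

text \<open>The factor \<open>m = i\<close> contains x_i - x_i. With \<open>r = n\<close> this
  annihilates every atom, which ends the Newton recursion.\<close>

lemma newton_kernel_eq_0:
  assumes "i < r" shows "newton_kernel d x a r s i j = 0"
proof -
  have "(\<Prod>m<r. ip d (\<lambda>t. x i t - x m t) (\<lambda>t. x j t - x m t)) = 0"
    using assms by (intro prod_zero) (auto intro!: bexI[of _ i] simp: ip_def)
  then show ?thesis unfolding newton_kernel_def by simp
qed

lemma ip_diff_le: "ip d (\<lambda>t. u t - v t) (\<lambda>t. u t - v t) \<le> 2 * ip d u u + 2 * ip d v v"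
proof -
  have "(u t - v t) * (u t - v t) \<le> 2 * (u t * u t) + 2 * (v t * v t)" for t
    using zero_le_square[of "u t + v t"] by (simp add: algebra_simps)
  then show ?thesis
    unfolding ip_def sum_distrib_left sum.distrib[symmetric] by (intro sum_mono)
qed

text \<open>Nodes are removed one at a time in favour of powers centred at the origin. The condition
  \<open>r + s < n\<close> keeps all tensor orders within the range controlled by
  \<open>M\<close>.\<close>

lemma newton_kernel_nodes_le:
  assumes x: "\<And>i. i < n \<Longrightarrow> ip d (x i) (x i) \<le> R\<^sup>2"
    and M: "\<And>l. l < n \<Longrightarrow> qform n c (\<lambda>i j. ip d (x i) (x j) ^ l) \<le> M"
    and M0: "0 \<le> M"
  shows "r + s < n \<Longrightarrow> qform n c (newton_kernel d x (\<lambda>_. 0) r s) \<le> (2 + 2 * R\<^sup>2) ^ r * M"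
proof (induction r arbitrary: s)
  case 0
  then show ?case using M[of s] by (simp add: newton_kernel_no_nodes)
next
  case (Suc r)
  have "qform n c (newton_kernel d x (\<lambda>_. 0) (Suc r) s)
     \<le> 2 * qform n c (newton_kernel d x (\<lambda>_. 0) r (Suc s))
       + 2 * ip d (x r) (x r) * qform n c (newton_kernel d x (\<lambda>_. 0) r s)"
    using newton_kernel_Suc_node_le[of n c d x "\<lambda>_. 0" r s] by (simp add: ip_def)
  also have "\<dots> \<le> 2 * ((2 + 2 * R\<^sup>2) ^ r * M) + 2 * R\<^sup>2 * ((2 + 2 * R\<^sup>2) ^ r * M)"
    using Suc.IH[of "Suc s"] Suc.IH[of s] Suc.prems x[of r]
    by (intro add_mono mult_mono) (auto simp: qform_newton_kernel_nonneg ip_self_nonneg)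
  also have "\<dots> = (2 + 2 * R\<^sup>2) ^ Suc r * M" by (simp add: algebra_simps)
  finally show ?case .
qed

text \<open>Induction on the power \<open>s\<close> for all \<open>r\<close> at once: each power
  becomes a node or is dropped, until no power is left or all \<open>n\<close> nodes are present and
  the form vanishes. Only the case \<open>r = 0\<close> is used later, but the recursion passes
  through every \<open>r\<close>.\<close>

lemma newton_kernel_le:
  assumes x: "\<And>i. i < n \<Longrightarrow> ip d (x i) (x i) \<le> R\<^sup>2" and a: "ip d a a \<le> R\<^sup>2"
    and M: "\<And>l. l < n \<Longrightarrow> qform n c (\<lambda>i j. ip d (x i) (x j) ^ l) \<le> M"
    and M0: "0 \<le> M"
  shows "r \<le> n \<Longrightarrow> qform n c (newton_kernel d x a r s) \<le> (2 + 2 * R\<^sup>2) ^ r * (4 + 12 * R\<^sup>2) ^ s * M"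
proof (induction s arbitrary: r)
  case 0
  show ?case
  proof (cases "r = n")
    case True
    then have "qform n c (newton_kernel d x a r 0) = 0"
      unfolding qform_def by (simp add: newton_kernel_eq_0)
    then show ?thesis using M0 by simp
  next
    case False
    \<comment> \<open>At power 0 the kernel does not depend on the centre, so the bound for centre 0
      applies.\<close>
    then show ?thesis using 0 newton_kernel_nodes_le[OF x M M0, of r 0]
      by (simp add: newton_kernel_power_0[of d x a r "\<lambda>_. 0"])
  qed
next
  case (Suc s)
  show ?case
  proof (cases "r = n")
    case True
    then have "qform n c (newton_kernel d x a r (Suc s)) = 0"
      unfolding qform_def by (simp add: newton_kernel_eq_0)
    then show ?thesis using M0 by simp
  next
    case False
    have ra: "ip d (\<lambda>t. x r t - a t) (\<lambda>t. x r t - a t) \<le> 4 * R\<^sup>2"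
      using ip_diff_le[of d "x r" a] x[of r] a False Suc.prems by simp
    let ?P = "(2 + 2 * R\<^sup>2) ^ r * (4 + 12 * R\<^sup>2) ^ s * M"
    have "qform n c (newton_kernel d x a r (Suc s))
       \<le> 2 * qform n c (newton_kernel d x a (Suc r) s)
         + 2 * ip d (\<lambda>t. x r t - a t) (\<lambda>t. x r t - a t) * qform n c (newton_kernel d x a r s)"
      by (rule newton_kernel_Suc_power_le)
    also have "\<dots> \<le> 2 * ((2 + 2 * R\<^sup>2) * ?P) + 2 * (4 * R\<^sup>2) * ?P"
      using Suc.IH[of "Suc r"] Suc.IH[of r] Suc.prems False ra
      by (intro add_mono mult_mono) (auto simp: mult_ac qform_newton_kernel_nonneg ip_self_nonneg)
    \<comment> \<open>The growth rate per power is 2 (2 + 2 R^2) + 8 R^2 = 4 + 12 R^2.\<close>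
    also have "\<dots> = (2 + 2 * R\<^sup>2) ^ r * (4 + 12 * R\<^sup>2) ^ Suc s * M"
      by (simp add: algebra_simps)
    finally show ?thesis .
  qed
qed

section \<open>Summation over all tensor orders by the exponential series\<close>

lemma exp_kernel_sums:
  "(\<lambda>l. qform n c (\<lambda>i j. \<kappa> i j ^ l) / fact l) sums qform n c (\<lambda>i j. exp (\<kappa> i j))"
proof -
  have "(\<lambda>l. y ^ l / fact l) sums exp y" for y :: real
    using exp_converges[of y] by (simp add: field_simps)
  then have "(\<lambda>l. \<Sum>i<n. \<Sum>j<n. c i * c j * (\<kappa> i j ^ l / fact l))
      sums (\<Sum>i<n. \<Sum>j<n. c i * c j * exp (\<kappa> i j))"
    by (intro sums_sum sums_mult)
  then show ?thesis
    unfolding qform_def by (simp add: sum_divide_distrib)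
qed

lemma exp_kernel_le:
  assumes x: "\<And>i. i < n \<Longrightarrow> ip d (x i) (x i) \<le> R\<^sup>2" and a: "ip d a a \<le> R\<^sup>2"
    and M: "\<And>l. l < n \<Longrightarrow> qform n c (\<lambda>i j. ip d (x i) (x j) ^ l) \<le> M"
    and M0: "0 \<le> M"
  shows "qform n c (\<lambda>i j. exp (ip d (\<lambda>t. x i t - a t) (\<lambda>t. x j t - a t)))
    \<le> exp (4 + 12 * R\<^sup>2) * M"
proof -
  let ?\<kappa> = "\<lambda>i j. ip d (\<lambda>t. x i t - a t) (\<lambda>t. x j t - a t)"
  have "(\<lambda>l. (4 + 12 * R\<^sup>2) ^ l /\<^sub>R fact l * M) sums (exp (4 + 12 * R\<^sup>2) * M)"
    by (rule sums_mult2[OF exp_converges])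
  then have majorant: "(\<lambda>l. (4 + 12 * R\<^sup>2) ^ l * M / fact l) sums (exp (4 + 12 * R\<^sup>2) * M)"
    by (simp add: field_simps)
  have "qform n c (\<lambda>i j. ?\<kappa> i j ^ l) / fact l \<le> (4 + 12 * R\<^sup>2) ^ l * M / fact l" for l
    using newton_kernel_le[OF x a M M0, of 0 l]
    unfolding newton_kernel_no_nodes by (intro divide_right_mono) simp_all
  from sums_le[OF this exp_kernel_sums majorant] show ?thesis .
qed

text \<open>Every term of the exponential series is nonnegative by positive semidefiniteness, so a
  single term is at most the sum.\<close>

lemma qform_ip_power_le_exp:
  "qform n c (\<lambda>i j. ip d (x i) (x j) ^ l) \<le> fact l * qform n c (\<lambda>i j. exp (ip d (x i) (x j)))"
proof -
  have nn: "0 \<le> qform n c (\<lambda>i j. ip d (x i) (x j) ^ l)" for l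
    using psd_mult_ip_power[OF psd_one, of n d x l] unfolding psd_def by simp
  note S = exp_kernel_sums[of n c "\<lambda>i j. ip d (x i) (x j)"]
  have "(\<Sum>l\<in>{l}. qform n c (\<lambda>i j. ip d (x i) (x j) ^ l) / fact l)
     \<le> (\<Sum>l. qform n c (\<lambda>i j. ip d (x i) (x j) ^ l) / fact l)"
    using S nn by (intro sum_le_suminf) (auto simp: sums_iff)
  then show ?thesis using S by (simp add: sums_iff divide_simps mult_ac)
qed

section \<open>Moment differences as quadratic forms\<close>

text \<open>Both mixtures are merged into one list of \<open>2*k\<close> atoms: indices from
  \<open>k\<close> on belong to the second one and carry its weights negated.\<close>

definition signed_weight :: "nat \<Rightarrow> (nat \<Rightarrow> real) \<Rightarrow> (nat \<Rightarrow> real) \<Rightarrow> nat \<Rightarrow> real" where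
  "signed_weight k w w' i = (if i < k then w i else - w' (i - k))"

definition joint_atom :: "nat \<Rightarrow> (nat \<Rightarrow> 'a) \<Rightarrow> (nat \<Rightarrow> 'a) \<Rightarrow> nat \<Rightarrow> 'a" where
  "joint_atom k \<mu> \<mu>' i = (if i < k then \<mu> i else \<mu>' (i - k))"

text \<open>\<open>F\<close> is arbitrary so that one identity serves total masses, moment entries
  and densities.\<close>

lemma sum_signed_weight:
  "(\<Sum>i<2*k. signed_weight k w w' i * F (joint_atom k \<mu> \<mu>' i)) =
   (\<Sum>j<k. w j * F (\<mu> j)) - (\<Sum>j<k. w' j * F (\<mu>' j))"
proof -
  let ?g = "\<lambda>i. signed_weight k w w' i * F (joint_atom k \<mu> \<mu>' i)"
  have "(\<Sum>i<2*k. ?g i) = (\<Sum>i=0..<k. ?g i) + (\<Sum>i=k..<2*k. ?g i)"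
    by (simp add: lessThan_atLeast0 sum.atLeastLessThan_concat)
  also have "(\<Sum>i=k..<2*k. ?g i) = (\<Sum>j=0..<k. - (w' j * F (\<mu>' j)))"
    using sum.shift_bounds_nat_ivl[of ?g 0 k k]
    by (simp add: mult_2 signed_weight_def joint_atom_def)
  also have "(\<Sum>i=0..<k. ?g i) = (\<Sum>j=0..<k. w j * F (\<mu> j))"
    by (intro sum.cong) (auto simp: signed_weight_def joint_atom_def)
  finally show ?thesis by (simp add: lessThan_atLeast0 sum_negf)
qed

lemma moment_diff_frob_sq_eq_qform:
  "moment_diff_frob_sq d k l w \<mu> w' \<mu>' =
   qform (2*k) (signed_weight k w w')
     (\<lambda>i j. ip d (joint_atom k \<mu> \<mu>' i) (joint_atom k \<mu> \<mu>' j) ^ l)"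
proof -
  let ?c = "signed_weight k w w'" and ?x = "joint_atom k \<mu> \<mu>'" and ?I = "PiE {..<l} (\<lambda>_. {..<d})"
  have "moment_diff_frob_sq d k l w \<mu> w' \<mu>' = (\<Sum>idx\<in>?I. (\<Sum>i<2*k. ?c i * (\<Prod>t<l. ?x i (idx t)))\<^sup>2)"
    unfolding moment_diff_frob_sq_def moment_entry_def
    by (intro sum.cong refl)
      (subst sum_signed_weight[of k w w' "\<lambda>u. \<Prod>t<l. u (_ t)"], rule refl)
  also have "\<dots> = (\<Sum>idx\<in>?I. \<Sum>i<2*k. \<Sum>j<2*k. ?c i * ?c j * (\<Prod>t<l. ?x i (idx t) * ?x j (idx t)))"
    by (simp add: power2_eq_square sum_product prod.distrib mult_ac)
  also have "\<dots> = (\<Sum>i<2*k. \<Sum>idx\<in>?I. \<Sum>j<2*k. ?c i * ?c j * (\<Prod>t<l. ?x i (idx t) * ?x j (idx t)))"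
    by (rule sum.swap)
  also have "\<dots> = (\<Sum>i<2*k. \<Sum>j<2*k. \<Sum>idx\<in>?I. ?c i * ?c j * (\<Prod>t<l. ?x i (idx t) * ?x j (idx t)))"
    by (intro sum.cong refl sum.swap)
  also have "\<dots> = (\<Sum>i<2*k. \<Sum>j<2*k. ?c i * ?c j * ip d (?x i) (?x j) ^ l)"
  proof (intro sum.cong refl)
    fix i j
    have "ip d (?x i) (?x j) ^ l = (\<Prod>t<l. \<Sum>a<d. ?x i a * ?x j a)"
      by (simp add: ip_def)
    \<comment> \<open>Distributivity: a product of \<open>l\<close> coordinate sums is a sum over
      all multi-indices.\<close>
    also have "\<dots> = (\<Sum>idx\<in>?I. \<Prod>t<l. ?x i (idx t) * ?x j (idx t))"
      by (rule prod_sum_PiE) simp_all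
    finally show "(\<Sum>idx\<in>?I. ?c i * ?c j * (\<Prod>t<l. ?x i (idx t) * ?x j (idx t)))
        = ?c i * ?c j * ip d (?x i) (?x j) ^ l"
      by (simp add: sum_distrib_left)
  qed
  finally show ?thesis unfolding qform_def .
qed

section \<open>Gaussian integrals\<close>

lemma gauss_density_eq_prod: "gauss_density d m x = (\<Prod>i<d. normal_density (m i) 1 (x i))"
proof -
  have "(2 * pi) powr (- real d / 2) = ((2 * pi) powr (- 1 / 2)) ^ d"
    by (simp add: powr_realpow[symmetric] powr_powr)
  also have "(2 * pi) powr (- 1 / 2) = 1 / sqrt (2 * pi)"
    by (simp add: powr_minus powr_half_sqrt inverse_eq_divide)
  finally show ?thesis
    by (simp add: gauss_density_def normal_density_def prod.distrib exp_sum[symmetric]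
        sum_negf sum_divide_distrib prod_dividef prod_constant power_divide)
qed

interpretation lborel_PiM: product_sigma_finite "\<lambda>_::nat. lborel :: real measure"
  by standard

lemma integrable_gauss_density: "integrable (lebesgue_d d) (gauss_density d m)"
  unfolding lebesgue_d_def gauss_density_eq_prod
  by (intro lborel_PiM.product_integrable_prod) simp_all

lemma integral_gauss_density: "(\<integral>x. gauss_density d m x \<partial>lebesgue_d d) = 1"
  unfolding lebesgue_d_def gauss_density_eq_prod
  by (subst lborel_PiM.product_integral_prod) simp_all

lemma gauss_density_pos: "0 < gauss_density d m x"
  unfolding gauss_density_def by simp

text \<open>Completing the square: the quotient is again a Gaussian, centred at a + b - m, up to a
  factor free of \<open>x\<close>. It therefore integrates to that factor.\<close>

lemma gauss_density_mult_div:
  "gauss_density d a x * gauss_density d b x / gauss_density d m x =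
   exp (ip d (\<lambda>t. a t - m t) (\<lambda>t. b t - m t)) * gauss_density d (\<lambda>t. a t + b t - m t) x"
proof -
  have "- (\<Sum>i<d. (x i - a i)\<^sup>2) / 2 + - (\<Sum>i<d. (x i - b i)\<^sup>2) / 2 =
     ip d (\<lambda>t. a t - m t) (\<lambda>t. b t - m t) + - (\<Sum>i<d. (x i - (a i + b i - m i))\<^sup>2) / 2
     + - (\<Sum>i<d. (x i - m i)\<^sup>2) / 2"
    unfolding ip_def sum_negf[symmetric] sum_divide_distrib sum.distrib[symmetric]
    by (intro sum.cong refl) (simp add: field_simps power2_eq_square)
  then show ?thesis
    by (simp add: gauss_density_def divide_simps flip: exp_add)
qed

lemma gauss_density_div_square:
  "gauss_density d m x / (gauss_density d (\<lambda>_. 0) x)\<^sup>2 =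
   exp (- ip d m m) / gauss_density d (\<lambda>t. - m t) x"
proof -
  have "- (\<Sum>i<d. (x i - m i)\<^sup>2) / 2 + - (\<Sum>i<d. (x i + m i)\<^sup>2) / 2 =
     - ip d m m + - (\<Sum>i<d. (x i)\<^sup>2) / 2 + - (\<Sum>i<d. (x i)\<^sup>2) / 2"
    unfolding ip_def sum_negf[symmetric] sum_divide_distrib sum.distrib[symmetric]
    by (intro sum.cong refl) (simp add: field_simps power2_eq_square)
  then show ?thesis
    by (simp add: gauss_density_def power2_eq_square divide_simps flip: exp_add)
qed

lemma has_bochner_integral_gauss_comb_square:
  "has_bochner_integral (lebesgue_d d)
     (\<lambda>x. (\<Sum>i<n. c i * gauss_density d (y i) x)\<^sup>2 / gauss_density d m x)
     (qform n c (\<lambda>i j. exp (ip d (\<lambda>t. y i t - m t) (\<lambda>t. y j t - m t))))"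
proof -
  have eq: "(\<Sum>i<n. c i * gauss_density d (y i) x)\<^sup>2 / gauss_density d m x =
    (\<Sum>i<n. \<Sum>j<n. c i * c j * (exp (ip d (\<lambda>t. y i t - m t) (\<lambda>t. y j t - m t))
        * gauss_density d (\<lambda>t. y i t + y j t - m t) x))" for x
    unfolding gauss_density_mult_div[symmetric]
    by (simp add: power2_eq_square sum_product sum_divide_distrib mult_ac)
  have "has_bochner_integral (lebesgue_d d) (\<lambda>x. c i * c j * (exp e * gauss_density d z x)) (c i * c j * exp e)"
    for i j e z
    using integrable_gauss_density integral_gauss_density
    by (simp add: has_bochner_integral_iff)
  then show ?thesis
    unfolding eq qform_def by (intro has_bochner_integral_sum)
qed

section \<open>Comparison of the divergences\<close>

text \<open>Both comparisons are pointwise after adding p - q, whose integral is 0; each comes from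
  ln t <= t - 1. Integrability is established throughout because a Bochner integral defaults to 0
  otherwise.\<close>

lemma divergence_chain:
  assumes p: "\<And>x. 0 < p x" and q: "\<And>x. 0 < q x"
    and ip: "integrable (lebesgue_d d) p" and iq: "integrable (lebesgue_d d) q"
    and eq: "(\<integral>x. p x \<partial>lebesgue_d d) = (\<integral>x. q x \<partial>lebesgue_d d)"
    and ichi: "integrable (lebesgue_d d) (\<lambda>x. (p x - q x)\<^sup>2 / q x)"
  shows "integrable (lebesgue_d d) (\<lambda>x. (sqrt (p x) - sqrt (q x))\<^sup>2)"
    and "hellinger_sq d p q \<le> kl_div d p q"
    and "kl_div d p q \<le> chi_sq d p q"
proof -
  have [measurable]: "p \<in> borel_measurable (lebesgue_d d)" "q \<in> borel_measurable (lebesgue_d d)"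
    using ip iq by auto
  have sq: "(sqrt (p x) - sqrt (q x))\<^sup>2 = p x + q x - 2 * sqrt (p x * q x)" for x
    using p[of x] q[of x] by (simp add: power2_diff real_sqrt_mult)
  have geo_nonneg: "sqrt (p x * q x) \<ge> 0" for x
    using p[of x] q[of x] by simp
  show iH: "integrable (lebesgue_d d) (\<lambda>x. (sqrt (p x) - sqrt (q x))\<^sup>2)"
  proof (rule Bochner_Integration.integrable_bound)
    show "integrable (lebesgue_d d) (\<lambda>x. p x + q x)" using ip iq by simp
    show "AE x in lebesgue_d d. norm ((sqrt (p x) - sqrt (q x))\<^sup>2) \<le> norm (p x + q x)"
    proof (rule AE_I2)
      fix x
      show "norm ((sqrt (p x) - sqrt (q x))\<^sup>2) \<le> norm (p x + q x)"
        using p[of x] q[of x] geo_nonneg[of x] zero_le_power2[of "sqrt (p x) - sqrt (q x)"]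
        unfolding sq real_norm_def by arith
    qed
  qed simp
  have lower: "(sqrt (p x) - sqrt (q x))\<^sup>2 + (p x - q x) \<le> p x * ln (p x / q x)" for x
  proof -
    have pq: "0 < p x" "0 < q x" using p q by auto
    \<comment> \<open>Using the square root of q/p as argument of the logarithm bound produces the
      Hellinger integrand.\<close>
    have "ln (sqrt (q x / p x)) \<le> sqrt (q x / p x) - 1"
      using pq by (intro ln_le_minus_one) simp
    then have "2 * (1 - sqrt (q x / p x)) \<le> ln (p x / q x)"
      using pq by (simp add: ln_sqrt ln_div)
    then have "p x * (2 * (1 - sqrt (q x / p x))) \<le> p x * ln (p x / q x)"
      using pq by (intro mult_left_mono) auto
    moreover have "p x * sqrt (q x / p x) = sqrt (p x * q x)"
      using pq by (simp add: real_sqrt_mult real_sqrt_divide field_simps)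
    ultimately show ?thesis by (simp add: sq algebra_simps)
  qed
  have upper: "p x * ln (p x / q x) \<le> (p x - q x)\<^sup>2 / q x + (p x - q x)" for x
  proof -
    have pq: "0 < p x" "0 < q x" using p q by auto
    have "p x * ln (p x / q x) \<le> p x * (p x / q x - 1)"
      using pq by (intro mult_left_mono ln_le_minus_one) auto
    also have "\<dots> = (p x - q x)\<^sup>2 / q x + (p x - q x)"
      using pq by (simp add: field_simps power2_eq_square)
    finally show ?thesis .
  qed
  \<comment> \<open>\<open>lower\<close> and \<open>upper\<close> enclose the integrand, so its
    absolute value is dominated by the sum of the integrable bounds.\<close>
  have iK: "integrable (lebesgue_d d) (\<lambda>x. p x * ln (p x / q x))"
  proof (rule Bochner_Integration.integrable_bound)
    show "integrable (lebesgue_d d)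
      (\<lambda>x. (p x - q x)\<^sup>2 / q x + (sqrt (p x) - sqrt (q x))\<^sup>2 + \<bar>p x - q x\<bar>)"
      using ichi iH ip iq by simp
    show "AE x in lebesgue_d d. norm (p x * ln (p x / q x)) \<le>
        norm ((p x - q x)\<^sup>2 / q x + (sqrt (p x) - sqrt (q x))\<^sup>2 + \<bar>p x - q x\<bar>)"
    proof (rule AE_I2)
      fix x
      have "0 \<le> (p x - q x)\<^sup>2 / q x" using q[of x] by simp
      moreover have "0 \<le> (sqrt (p x) - sqrt (q x))\<^sup>2" by simp
      ultimately show "norm (p x * ln (p x / q x)) \<le>
        norm ((p x - q x)\<^sup>2 / q x + (sqrt (p x) - sqrt (q x))\<^sup>2 + \<bar>p x - q x\<bar>)"
        using lower[of x] upper[of x] unfolding real_norm_def by arith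
    qed
  qed simp
  have "hellinger_sq d p q = (\<integral>x. (sqrt (p x) - sqrt (q x))\<^sup>2 + (p x - q x) \<partial>lebesgue_d d)"
    using iH ip iq eq by (simp add: hellinger_sq_def)
  also have "\<dots> \<le> kl_div d p q"
    unfolding kl_div_def using iH ip iq iK lower by (intro integral_mono) auto
  finally show "hellinger_sq d p q \<le> kl_div d p q" .
  have "kl_div d p q \<le> (\<integral>x. (p x - q x)\<^sup>2 / q x + (p x - q x) \<partial>lebesgue_d d)"
    unfolding kl_div_def using ichi ip iq iK upper by (intro integral_mono) auto
  also have "\<dots> = chi_sq d p q"
    using ichi ip iq eq by (simp add: chi_sq_def)
  finally show "kl_div d p q \<le> chi_sq d p q" .
qed

section \<open>Pairs of mixtures\<close>

lemma mixture_density_pos: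
  assumes "katomic_ball R d k w \<mu>" shows "0 < mixture_density d k w \<mu> x"
proof -
  have "\<exists>j<k. 0 < w j"
  proof (rule ccontr)
    assume "\<not> ?thesis"
    then have "(\<Sum>j<k. w j) \<le> 0" by (intro sum_nonpos) force
    with assms show False by (simp add: katomic_ball_def)
  qed
  then obtain j where "j < k" "0 < w j" by blast
  with assms show ?thesis
    unfolding mixture_density_def katomic_ball_def
    by (intro sum_pos2[of _ j]) (auto simp: gauss_density_pos less_imp_le)
qed

lemma has_bochner_integral_mixture_density:
  assumes "katomic_ball R d k w \<mu>"
  shows "has_bochner_integral (lebesgue_d d) (mixture_density d k w \<mu>) 1"
proof -
  have "has_bochner_integral (lebesgue_d d) (\<lambda>x. \<Sum>j<k. w j * gauss_density d (\<mu> j) x) (\<Sum>j<k. w j * 1)"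
    using integrable_gauss_density integral_gauss_density
    by (intro has_bochner_integral_sum) (simp add: has_bochner_integral_iff)
  with assms show ?thesis
    by (simp add: mixture_density_def[abs_def] katomic_ball_def)
qed

lemma katomic_ball_norm_sq:
  assumes "katomic_ball R d k w \<mu>" "j < k" shows "ip d (\<mu> j) (\<mu> j) \<le> R\<^sup>2"
proof -
  have "sqrt (ip d (\<mu> j) (\<mu> j)) \<le> R"
    using assms by (simp add: katomic_ball_def eucl_norm_def ip_def power2_eq_square)
  then show ?thesis by (rule sqrt_le_D)
qed

lemma weighted_am_gm:
  fixes s u v :: real
  assumes "0 < s" shows "u * v \<le> s / 2 * u\<^sup>2 + 1 / (2 * s) * v\<^sup>2"
proof -
  have "0 \<le> (s * u - v)\<^sup>2 / (2 * s)" using assms by simp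
  also have "\<dots> = s / 2 * u\<^sup>2 + 1 / (2 * s) * v\<^sup>2 - u * v"
    using assms by (simp add: field_simps power2_eq_square)
  finally show ?thesis by simp
qed

section \<open>Comparison of \<open>E\<close> with the largest moment difference
  \<open>M\<close>\<close>

locale mixture_pair =
  fixes R :: real and d k :: nat and w w' :: "nat \<Rightarrow> real" and \<mu> \<mu>' :: "nat \<Rightarrow> nat \<Rightarrow> real"
  assumes P: "katomic_ball R d k w \<mu>" and Q: "katomic_ball R d k w' \<mu>'"
begin

abbreviation "p \<equiv> mixture_density d k w \<mu>"
abbreviation "q \<equiv> mixture_density d k w' \<mu>'"
abbreviation "c \<equiv> signed_weight k w w'"
abbreviation "y \<equiv> joint_atom k \<mu> \<mu>'"
abbreviation "phi \<equiv> gauss_density d"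

definition M :: real where
  "M = Max ((\<lambda>l. moment_diff_frob_sq d k l w \<mu> w' \<mu>') ` {1..2*k-1})"

definition E :: "(nat \<Rightarrow> real) \<Rightarrow> real" where
  "E m = qform (2*k) c (\<lambda>i j. exp (ip d (\<lambda>t. y i t - m t) (\<lambda>t. y j t - m t)))"

text \<open>An empty sum of weights cannot be 1. Hence \<open>{1..2*k-1}\<close> is nonempty and its
  \<open>Max\<close> is attained.\<close>

lemma k_pos: "0 < k"
  using P unfolding katomic_ball_def by (cases k) auto

lemma M_attained:
  obtains l where "l < 2*k" "M = moment_diff_frob_sq d k l w \<mu> w' \<mu>'"
proof -
  have "M \<in> (\<lambda>l. moment_diff_frob_sq d k l w \<mu> w' \<mu>') ` {1..2*k-1}"
    unfolding M_def using k_pos by (intro Max_in) auto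
  then obtain l where l: "l \<in> {1..2*k-1}" "M = moment_diff_frob_sq d k l w \<mu> w' \<mu>'" by blast
  from l(1) k_pos have "l < 2*k" by auto
  from this l(2) show ?thesis by (rule that)
qed

lemma M_nonneg: "0 \<le> M"
  by (rule M_attained) (simp add: moment_diff_frob_sq_def sum_nonneg)

lemma moment_le_M:
  assumes "l < 2*k" shows "qform (2*k) c (\<lambda>i j. ip d (y i) (y j) ^ l) \<le> M"
proof (cases "l = 0")
  case True
  \<comment> \<open>Order 0 is outside the range of \<open>M\<close> but enters the Newton bound; it
    vanishes since both total masses are 1.\<close>
  have "(\<Sum>i<2*k. c i) = 0"
    using sum_signed_weight[of k w w' "\<lambda>_. 1" \<mu> \<mu>'] P Q by (simp add: katomic_ball_def)
  then have "qform (2*k) c (\<lambda>i j. 1) = 0"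
    unfolding qform_def by (simp flip: sum_product)
  with True M_nonneg show ?thesis by simp
next
  case False
  with assms show ?thesis
    unfolding moment_diff_frob_sq_eq_qform[symmetric] M_def by (intro Max_ge) auto
qed

lemma joint_atom_norm_sq: "i < 2*k \<Longrightarrow> ip d (y i) (y i) \<le> R\<^sup>2"
  using katomic_ball_norm_sq[OF P] katomic_ball_norm_sq[OF Q] by (simp add: joint_atom_def)

lemma E_le: "ip d m m \<le> R\<^sup>2 \<Longrightarrow> E m \<le> exp (4 + 12 * R\<^sup>2) * M"
  unfolding E_def by (intro exp_kernel_le joint_atom_norm_sq moment_le_M M_nonneg)

lemma M_le_E0: "M \<le> fact (2*k) * E (\<lambda>_. 0)"
proof -
  obtain l where l: "l < 2*k" "M = moment_diff_frob_sq d k l w \<mu> w' \<mu>'" by (rule M_attained)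
  have "M \<le> fact l * E (\<lambda>_. 0)"
    using l(2) qform_ip_power_le_exp[of "2*k" c d y l]
    by (simp add: moment_diff_frob_sq_eq_qform E_def)
  moreover from this have "0 \<le> E (\<lambda>_. 0)"
    using M_nonneg by (metis fact_gt_zero order_trans zero_le_mult_iff not_less)
  ultimately show ?thesis
    using l(1) by (meson fact_mono less_imp_le mult_right_mono order_trans)
qed

lemma diff_eq: "p x - q x = (\<Sum>i<2*k. c i * phi (y i) x)"
  using sum_signed_weight[of k w w' "\<lambda>u. phi u x" \<mu> \<mu>'] by (simp add: mixture_density_def)

lemma has_integral_E: "has_bochner_integral (lebesgue_d d) (\<lambda>x. (p x - q x)\<^sup>2 / phi m x) (E m)"
  unfolding diff_eq E_def by (rule has_bochner_integral_gauss_comb_square)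

lemma pq_pos: "0 < p x" "0 < q x"
  using mixture_density_pos[OF P] mixture_density_pos[OF Q] by blast+

lemma measurable_pq [measurable]:
  "p \<in> borel_measurable (lebesgue_d d)" "q \<in> borel_measurable (lebesgue_d d)"
  using has_bochner_integral_mixture_density[OF P] has_bochner_integral_mixture_density[OF Q]
  by (auto simp: has_bochner_integral_iff)

section \<open>Upper bound for the chi-square divergence\<close>

lemma
  shows integrable_chi_sq: "integrable (lebesgue_d d) (\<lambda>x. (p x - q x)\<^sup>2 / q x)"
    and chi_sq_le: "chi_sq d p q \<le> real k * (exp (4 + 12 * R\<^sup>2) * M)"
proof -
  \<comment> \<open>An atom of weight at least \<open>1 / k\<close> gives a Gaussian minorant of \<open>k * q\<close>.\<close>
  have "\<exists>j<k. 1 / real k \<le> w' j"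
  proof (rule ccontr)
    assume "\<not> ?thesis"
    then have "(\<Sum>j<k. w' j) < (\<Sum>j<k. 1 / real k)"
      using k_pos by (intro sum_strict_mono) auto
    with Q k_pos show False by (simp add: katomic_ball_def)
  qed
  then obtain j where j: "j < k" "1 / real k \<le> w' j" by blast
  have q_ge: "phi (\<mu>' j) x / real k \<le> q x" for x
  proof -
    have "phi (\<mu>' j) x / real k \<le> w' j * phi (\<mu>' j) x"
      using mult_right_mono[OF j(2), of "phi (\<mu>' j) x"] gauss_density_pos[of d "\<mu>' j" x] by simp
    also have "\<dots> \<le> q x"
      unfolding mixture_density_def using Q j(1)
      by (intro member_le_sum) (auto simp: katomic_ball_def gauss_density_pos less_imp_le)
    finally show ?thesis .
  qed
  have bound: "(p x - q x)\<^sup>2 / q x \<le> real k * ((p x - q x)\<^sup>2 / phi (\<mu>' j) x)" for x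
    using divide_left_mono[OF q_ge, of "(p x - q x)\<^sup>2" x] gauss_density_pos[of d "\<mu>' j" x] pq_pos[of x] k_pos
    by (simp add: field_simps)
  have int: "integrable (lebesgue_d d) (\<lambda>x. real k * ((p x - q x)\<^sup>2 / phi (\<mu>' j) x))"
    using has_integral_E by (intro integrable_mult_right) (auto simp: has_bochner_integral_iff)
  show i: "integrable (lebesgue_d d) (\<lambda>x. (p x - q x)\<^sup>2 / q x)"
  proof (rule Bochner_Integration.integrable_bound[OF int])
    show "AE x in lebesgue_d d. norm ((p x - q x)\<^sup>2 / q x)
        \<le> norm (real k * ((p x - q x)\<^sup>2 / phi (\<mu>' j) x))"
    proof (rule AE_I2)
      fix x
      have "0 \<le> (p x - q x)\<^sup>2 / q x" using pq_pos[of x] by simp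
      with bound[of x] show "norm ((p x - q x)\<^sup>2 / q x)
          \<le> norm (real k * ((p x - q x)\<^sup>2 / phi (\<mu>' j) x))"
        unfolding real_norm_def by linarith
    qed
  qed simp
  have "chi_sq d p q \<le> (\<integral>x. real k * ((p x - q x)\<^sup>2 / phi (\<mu>' j) x) \<partial>lebesgue_d d)"
    unfolding chi_sq_def using i int bound by (intro integral_mono)
  also have "\<dots> = real k * E (\<mu>' j)"
    unfolding integral_mult_right_zero
    using has_integral_E by (simp add: has_bochner_integral_iff)
  \<comment> \<open>The centre is an atom of the second mixture, hence lies in the ball where
    \<open>E_le\<close> holds.\<close>
  also have "\<dots> \<le> real k * (exp (4 + 12 * R\<^sup>2) * M)"
    using E_le katomic_ball_norm_sq[OF Q j(1)] by (intro mult_left_mono) auto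
  finally show "chi_sq d p q \<le> real k * (exp (4 + 12 * R\<^sup>2) * M)" .
qed

lemma divergence_order:
  "hellinger_sq d p q \<le> kl_div d p q" "kl_div d p q \<le> chi_sq d p q"
  and integrable_hellinger_sq: "integrable (lebesgue_d d) (\<lambda>x. (sqrt (p x) - sqrt (q x))\<^sup>2)"
  using divergence_chain[of p q d] pq_pos integrable_chi_sq
    has_bochner_integral_mixture_density[OF P] has_bochner_integral_mixture_density[OF Q]
  by (auto simp: has_bochner_integral_iff)

section \<open>Lower bound for the Hellinger distance\<close>

text \<open>Each component of the mixture turns the integral into \<open>E\<close> at the reflected
  atom, which has the same norm. The mixture is generic so that the bound covers both
  \<open>p\<close> and \<open>q\<close>.\<close>

lemma test_function_second_moment:
  assumes "katomic_ball R d k v \<nu>"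
  shows "integrable (lebesgue_d d) (\<lambda>x. ((p x - q x) / phi (\<lambda>_. 0) x)\<^sup>2 * mixture_density d k v \<nu> x)"
    and "(\<integral>x. ((p x - q x) / phi (\<lambda>_. 0) x)\<^sup>2 * mixture_density d k v \<nu> x \<partial>lebesgue_d d)
      \<le> exp (4 + 12 * R\<^sup>2) * M"
proof -
  let ?f = "\<lambda>x. ((p x - q x) / phi (\<lambda>_. 0) x)\<^sup>2 * mixture_density d k v \<nu> x"
  let ?e = "\<lambda>j. exp (- ip d (\<nu> j) (\<nu> j))"
  have f_eq: "?f x = (\<Sum>j<k. v j * (?e j * ((p x - q x)\<^sup>2 / phi (\<lambda>t. - \<nu> j t) x)))" for x
  proof -
    have "?f x = (\<Sum>j<k. v j * ((p x - q x)\<^sup>2 * (phi (\<nu> j) x / (phi (\<lambda>_. 0) x)\<^sup>2)))"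
      unfolding mixture_density_def[of d k v] sum_distrib_left
      by (intro sum.cong refl) (simp add: power_divide)
    then show ?thesis
      unfolding gauss_density_div_square by (simp add: mult_ac)
  qed
  have "has_bochner_integral (lebesgue_d d) ?f (\<Sum>j<k. v j * (?e j * E (\<lambda>t. - \<nu> j t)))"
    unfolding f_eq
    by (intro has_bochner_integral_sum has_bochner_integral_mult_right has_integral_E)
  moreover have "(\<Sum>j<k. v j * (?e j * E (\<lambda>t. - \<nu> j t))) \<le> (\<Sum>j<k. v j * (exp (4 + 12 * R\<^sup>2) * M))"
  proof (rule sum_mono)
    fix j assume "j \<in> {..<k}"
    then have j: "j < k" "0 \<le> v j" using assms by (auto simp: katomic_ball_def)
    have "E (\<lambda>t. - \<nu> j t) \<le> exp (4 + 12 * R\<^sup>2) * M"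
      using katomic_ball_norm_sq[OF assms j(1)] by (intro E_le) (simp add: ip_def)
    then have "?e j * E (\<lambda>t. - \<nu> j t) \<le> 1 * (exp (4 + 12 * R\<^sup>2) * M)"
      using M_nonneg ip_self_nonneg[of d "\<nu> j"]
      by (meson exp_ge_zero exp_le_one_iff mult_left_mono mult_right_mono mult_nonneg_nonneg
          neg_le_0_iff_le order_trans)
    then show "v j * (?e j * E (\<lambda>t. - \<nu> j t)) \<le> v j * (exp (4 + 12 * R\<^sup>2) * M)"
      using j by (intro mult_left_mono) auto
  qed
  moreover have "(\<Sum>j<k. v j * (exp (4 + 12 * R\<^sup>2) * M)) = exp (4 + 12 * R\<^sup>2) * M"
    using assms by (simp add: katomic_ball_def flip: sum_distrib_right)
  ultimately show "integrable (lebesgue_d d) ?f"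
    and "(\<integral>x. ?f x \<partial>lebesgue_d d) \<le> exp (4 + 12 * R\<^sup>2) * M"
    by (auto simp: has_bochner_integral_iff)
qed

text \<open>The parameter \<open>s\<close> stays free so that the \<open>M\<close> term can later be
  made small enough to absorb.\<close>

lemma E0_le_hellinger_sq:
  assumes s: "0 < s"
  shows "E (\<lambda>_. 0) \<le> s / 2 * hellinger_sq d p q + 2 / s * (exp (4 + 12 * R\<^sup>2) * M)"
proof -
  let ?f = "\<lambda>x. (p x - q x) / phi (\<lambda>_. 0) x" and ?L = "lebesgue_d d"
  let ?h = "\<lambda>x. (sqrt (p x) - sqrt (q x))\<^sup>2"
  have point: "(p x - q x)\<^sup>2 / phi (\<lambda>_. 0) x \<le> s / 2 * ?h x + 1 / s * ((?f x)\<^sup>2 * p x + (?f x)\<^sup>2 * q x)" for x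
  proof -
    define a b where "a = sqrt (p x)" and "b = sqrt (q x)"
    have pq: "p x = a\<^sup>2" "q x = b\<^sup>2" using pq_pos[of x] by (simp_all add: a_def b_def)
    \<comment> \<open>Factor p - q as (a - b) (a + b): the first factor gives the Hellinger
      integrand, the second goes with the test function.\<close>
    have "(p x - q x)\<^sup>2 / phi (\<lambda>_. 0) x = (a - b) * (?f x * (a + b))"
      by (simp add: pq power2_eq_square algebra_simps)
    also have "\<dots> \<le> s / 2 * (a - b)\<^sup>2 + 1 / (2 * s) * (?f x * (a + b))\<^sup>2"
      using s by (rule weighted_am_gm)
    also have "1 / (2 * s) * (?f x * (a + b))\<^sup>2 \<le> 1 / (2 * s) * ((?f x)\<^sup>2 * (2 * a\<^sup>2 + 2 * b\<^sup>2))"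
    proof -
      have "(a + b)\<^sup>2 \<le> 2 * a\<^sup>2 + 2 * b\<^sup>2"
        using zero_le_power2[of "a - b"] by (simp add: power2_sum power2_diff)
      then show ?thesis
        unfolding power_mult_distrib using s by (intro mult_left_mono) auto
    qed
    also have "\<dots> = 1 / s * ((?f x)\<^sup>2 * p x + (?f x)\<^sup>2 * q x)"
    proof -
      have "1 / (2 * s) * (r * (2 * u + 2 * v)) = 1 / s * (r * u + r * v)" for r u v
        using s by (simp add: field_simps)
      from this[of "(?f x)\<^sup>2" "p x" "q x"] show ?thesis unfolding pq .
    qed
    finally show ?thesis by (simp add: a_def b_def)
  qed
  note iH = integrable_hellinger_sq
  note ip = test_function_second_moment(1)[OF P] and iq = test_function_second_moment(1)[OF Q]
  have "E (\<lambda>_. 0) = (\<integral>x. (p x - q x)\<^sup>2 / phi (\<lambda>_. 0) x \<partial>?L)"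
    using has_integral_E by (simp add: has_bochner_integral_iff)
  also have "\<dots> \<le> (\<integral>x. s / 2 * ?h x + 1 / s * ((?f x)\<^sup>2 * p x + (?f x)\<^sup>2 * q x) \<partial>?L)"
    using has_integral_E iH ip iq point
    by (intro integral_mono Bochner_Integration.integrable_add integrable_mult_right)
      (auto simp: has_bochner_integral_iff)
  also have "\<dots> = (\<integral>x. s / 2 * ?h x \<partial>?L) + (\<integral>x. 1 / s * ((?f x)\<^sup>2 * p x + (?f x)\<^sup>2 * q x) \<partial>?L)"
    using iH ip iq
    by (intro Bochner_Integration.integral_add Bochner_Integration.integrable_add integrable_mult_right)
  also have "\<dots> = s / 2 * hellinger_sq d p q
      + 1 / s * ((\<integral>x. (?f x)\<^sup>2 * p x \<partial>?L) + (\<integral>x. (?f x)\<^sup>2 * q x \<partial>?L))"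
    unfolding integral_mult_right_zero Bochner_Integration.integral_add[OF ip iq] hellinger_sq_def ..
  also have "\<dots> \<le> s / 2 * hellinger_sq d p q
      + 1 / s * (exp (4 + 12 * R\<^sup>2) * M + exp (4 + 12 * R\<^sup>2) * M)"
    using s test_function_second_moment(2)[OF P] test_function_second_moment(2)[OF Q]
    by (intro add_left_mono mult_left_mono add_mono) auto
  finally show ?thesis by (simp add: mult_ac)
qed

lemma M_le_hellinger_sq:
  "M \<le> 4 * exp (4 + 12 * R\<^sup>2) * (fact (2*k))\<^sup>2 * hellinger_sq d p q"
proof -
  define K F :: real where "K = exp (4 + 12 * R\<^sup>2)" and "F = fact (2*k)"
  have pos: "0 < K" "0 < F" by (simp_all add: K_def F_def)
  have "M \<le> F * E (\<lambda>_. 0)" using M_le_E0 by (simp add: F_def)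
  \<comment> \<open>The choice s = 4 K F turns the last term into M / 2, which is absorbed on the
    left.\<close>
  also have "\<dots> \<le> F * (4 * K * F / 2 * hellinger_sq d p q + 2 / (4 * K * F) * (K * M))"
    using E0_le_hellinger_sq[of "4 * K * F"] pos
    by (intro mult_left_mono) (auto simp: K_def)
  also have "\<dots> = 2 * K * F\<^sup>2 * hellinger_sq d p q + M / 2"
    using pos by (simp add: field_simps power2_eq_square)
  finally show ?thesis by (simp add: K_def F_def)
qed

lemma moment_lower_bound:
  "(1 / (8 * exp (4 + 12 * R\<^sup>2) * real k) ^ (4*k)) * M \<le> hellinger_sq d p q"
proof -
  define K :: real where "K = exp (4 + 12 * R\<^sup>2)"
  have K: "1 \<le> K" by (simp add: K_def)
  have H: "0 \<le> hellinger_sq d p q" unfolding hellinger_sq_def by simp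
  have "(fact (2*k) :: real) \<le> (2 * real k) ^ (2*k)"
    using fact_le_power[of "2*k", where 'a=real] by simp
  then have "(fact (2*k) :: real)\<^sup>2 \<le> ((2 * real k) ^ (2*k))\<^sup>2"
    by (intro power_mono) auto
  also have "\<dots> = (2 * real k) ^ (4*k)" unfolding power_mult[symmetric] by (simp add: mult_ac)
  finally have F: "(fact (2*k) :: real)\<^sup>2 \<le> (2 * real k) ^ (4*k)" .
  \<comment> \<open>Raising \<open>4 * K\<close> to the power \<open>4*k\<close> lets it merge with
    \<open>2 * real k\<close> into the single base \<open>8 * K * real k\<close>.\<close>
  have K4: "4 * K \<le> (4 * K) ^ (4*k)"
    using K k_pos by (intro self_le_power) auto
  have "M \<le> 4 * K * (fact (2*k))\<^sup>2 * hellinger_sq d p q"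
    using M_le_hellinger_sq by (simp add: K_def)
  also have "\<dots> \<le> (4 * K) ^ (4*k) * (2 * real k) ^ (4*k) * hellinger_sq d p q"
    using F K4 K H by (intro mult_right_mono mult_mono) auto
  also have "\<dots> = (8 * K * real k) ^ (4*k) * hellinger_sq d p q"
    unfolding power_mult_distrib[symmetric] by (simp add: mult_ac)
  finally have "M \<le> (8 * K * real k) ^ (4*k) * hellinger_sq d p q" .
  moreover have "0 < (8 * K * real k) ^ (4*k)"
    using K k_pos by (intro zero_less_power mult_pos_pos) auto
  ultimately have "M / (8 * K * real k) ^ (4*k) \<le> hellinger_sq d p q"
    by (subst pos_divide_le_eq) (simp_all only: mult.commute)
  then show ?thesis
    unfolding K_def[symmetric] times_divide_eq_left mult_1 .
qed

text \<open>The factor \<open>real k\<close> of \<open>chi_sq_le\<close> is absorbed through k <=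
  k^2 <= exp (36 k^2).\<close>

lemma moment_upper_bound:
  "chi_sq d p q \<le> 8 * exp (4 + 12 * R\<^sup>2) * exp (36 * (real k)\<^sup>2) * M"
proof -
  have "real k \<le> (real k)\<^sup>2" using k_pos by (simp add: power2_eq_square)
  also have "\<dots> \<le> exp (36 * (real k)\<^sup>2)"
    using exp_ge_add_one_self[of "36 * (real k)\<^sup>2"] zero_le_power2[of "real k"] by linarith
  finally have "real k \<le> 8 * exp (36 * (real k)\<^sup>2)"
    using exp_ge_zero[of "36 * (real k)\<^sup>2"] by linarith
  then have "real k * (exp (4 + 12 * R\<^sup>2) * M) \<le> 8 * exp (36 * (real k)\<^sup>2) * (exp (4 + 12 * R\<^sup>2) * M)"
    using M_nonneg by (intro mult_right_mono) auto
  with chi_sq_le show ?thesis by (simp add: mult_ac)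
qed

end

theorem mainTheorem7:
  fixes R :: real
  assumes "R > 0"
  shows "\<exists>C>0. \<forall>(k::nat) (d::nat) w \<mu> w' \<mu>'.
           d \<ge> 1 \<and> katomic_ball R d k w \<mu> \<and> katomic_ball R d k w' \<mu>' \<longrightarrow>
           (\<forall>D \<in> {hellinger_sq, kl_div, chi_sq}.
              let M = Max ((\<lambda>l. moment_diff_frob_sq d k l w \<mu> w' \<mu>') ` {1..2*k-1});
                  v = D d (mixture_density d k w \<mu>) (mixture_density d k w' \<mu>')
              in (1 / (C * real k) ^ (4*k)) * M \<le> v \<and> v \<le> C * exp (36 * (real k)\<^sup>2) * M)"
\<comment> \<open>The factor 8 is dictated by the base in \<open>moment_lower_bound\<close>; the
  upper bound is stated with the same constant.\<close>
proof (intro exI[of _ "8 * exp (4 + 12 * R\<^sup>2)"] conjI allI impI ballI)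
  fix k d :: nat and w w' :: "nat \<Rightarrow> real" and \<mu> \<mu>' :: "nat \<Rightarrow> nat \<Rightarrow> real" and D
  assume "d \<ge> 1 \<and> katomic_ball R d k w \<mu> \<and> katomic_ball R d k w' \<mu>'"
  then interpret mixture_pair R d k w w' \<mu> \<mu>' by unfold_locales auto
  assume "D \<in> {hellinger_sq, kl_div, chi_sq}"
  then have "hellinger_sq d p q \<le> D d p q" "D d p q \<le> chi_sq d p q"
    using divergence_order by auto
  then show "let M = Max ((\<lambda>l. moment_diff_frob_sq d k l w \<mu> w' \<mu>') ` {1..2*k-1});
       v = D d p q
     in (1 / (8 * exp (4 + 12 * R\<^sup>2) * real k) ^ (4*k)) * M \<le> v
        \<and> v \<le> 8 * exp (4 + 12 * R\<^sup>2) * exp (36 * (real k)\<^sup>2) * M"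
    unfolding Let_def M_def[symmetric]
    using moment_lower_bound moment_upper_bound by linarith
qed simp

end
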